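(* For every $M\ge 2$ there exists an SPQN over the edge variables $\mathbf E$ of graphs on $M$ vertices, of size $O(M^4)$, which is conditionally complete, conditionally decomposable and conditionally sound, and whose output $\Psi$ restricted to $\{0,1\}^N$ equals a strictly positive distribution on triangle-free graphs on $M$ vertices. Moreover, if one restricts to SPQNs composed entirely of valid CMO nodes, there exist such SPQNs of size $O(M^4)$ whose outputs approximate a strictly positive distribution on triangle-free graphs on $M$ vertices arbitrarily well (i.e. a sequence of them, each of size $O(M^4)$, converges pointwise on $\{0,1\}^N$ to such a distribution).
   Context: Edge variables: $\mathbf E=\{E_{ij}:1\le i<j\le M\}$ binary, $N=\binom M2$; $E_{ij}=1$ means edge $\{i,j\}$ is present. A graph contains a triangle iff there exist $i_1<i_2<i_3$ with $E_{i_1i_2}=E_{i_2i_3}=E_{i_1i_3}=1$. A probability function $d$ on $\{0,1\}^N$ is a strictly positive distribution on triangle-free graphs if $d(\mathbf E)>0$ exactly when the encoded graph is triangle-free. An SPQN over binary variables is a rooted DAG evaluated on $\{0,1,*\}^N$ with leaves $\mathbb 1[x_i=a]$ (value $1$ if $x_i=*$), sum nodes (weighted sums with strictly positive weights summing to $1$), product nodes, and quotient nodes $v$ with two children $\mathrm{num}(v),\mathrm{den}(v)$ computing $\Psi_{\mathrm{num}(v)}/\Psi_{\mathrm{den}(v)}$. Its size is the number of internal nodes. Scope: $\mathrm{sc}(v)=\{i\}$ for a leaf of variable $i$, else the union of children's scopes. Effective scope: $\{i\}$ for a leaf; union of children's effective scopes for sum/product nodes; $\mathrm{eff}(\mathrm{num}(v))\setminus\mathrm{eff}(\mathrm{den}(v))$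 for quotient nodes. $\mathrm{cond}(v)=\mathrm{sc}(v)\setminus\mathrm{eff}(v)$. Conditionally complete: children of each sum node have equal effective scopes. Conditionally decomposable: for each product node, distinct children have disjoint effective scopes and the directed graph on its children with edges $c'\to c''$ whenever $\mathrm{eff}(c')\cap\mathrm{cond}(c'')\ne\emptyset$ is acyclic. Conditionally sound: for each quotient node $v$, $\Psi_{\mathrm{den}(v)}$ is strictly positive, $\mathrm{cond}(\mathrm{den}(v))\subseteq\mathrm{cond}(\mathrm{num}(v))$, $\mathrm{eff}(\mathrm{den}(v))\subseteq\mathrm{eff}(\mathrm{num}(v))$, and $\Psi_{\mathrm{den}(v)}(\mathbf a)=\sum_{\mathbf z}\Psi_{\mathrm{num}(v)}(\mathbf z)$ for all $\mathbf a\in\{0,1,*\}^N$, summing over $\mathbf z$ with $z_i=a_i$ for $i\notin\mathrm{eff}(v)$ and $z_i\in\{0,1\}$ for $i\in\mathrm{eff}(v)$. CMO node: given $\alpha\ge0,\beta>0,\gamma\ge1$, strictly positive weights $\mathbf w$ summing to $1$, and children $a_{ij}$ ($i\le\gamma,j\le\alpha$), $b_{ij}$ ($i\le\gamma,j\le\beta$), it is a quotient node computing $\frac{\sum_i w_i(\prod_jA_{ij})(\prod_jB_{ij})}{\sum_i w_i\prod_jA_{ij}}$ with $A_{ij}=\Psi_{a_{ij}}$, $B_{ij}=\Psi_{b_{ij}}$, built from internal product nodes $P^A_i=\prod_jA_{ij}$, $P^B_i=\prod_jB_{ij}$, $p_i=P^A_iP^B_i$ and internal sum nodes (weights $\mathbf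 w$) over the $p_i$ (numerator) and over the $P^A_i$ (denominator). It is valid if: (1) its children are valid CMO nodes, or $\alpha=0,\beta=1,\gamma=2$ and its children are exactly $\mathbb 1[x_i=0],\mathbb 1[x_i=1]$ for some $i$; (2) its internal sum nodes are conditionally complete; (3) its internal product nodes are conditionally decomposable and in the dependency graph of each $p_i$ there is no edge from $P^B_i$ to $P^A_i$; (4) $\mathrm{eff}(P^B_{i_1})=\mathrm{eff}(P^B_{i_2})$ for all $i_1,i_2$. An SPQN is composed of valid CMO nodes if its root is a valid CMO node. *)

theory Defs
  imports Complex_Main
begin

text \<open>Nodes of a DAG are numbered 0 ..< nnodes; every child of node v has an index
  smaller than v (a topological numbering, so the graph is acyclic).
  Leaf x a is the indicator 1[x_i = a] (value 1 if x_i = *).\<close>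

datatype 'v node = Leaf 'v bool | SumN "(real \<times> nat) list" | ProdN "nat list" | QuotN nat nat

record 'v spqn =
  nnodes :: nat
  lab :: "nat \<Rightarrow> 'v node"
  root :: nat

fun children :: "'v node \<Rightarrow> nat list" where
  "children (Leaf x b) = []"
| "children (SumN ws) = map snd ws"
| "children (ProdN cs) = cs"
| "children (QuotN n d) = [n, d]"

fun is_leaf :: "'v node \<Rightarrow> bool" where
  "is_leaf (Leaf x b) = True"
| "is_leaf _ = False"

fun bu :: "((nat \<Rightarrow> 'b) \<Rightarrow> 'v node \<Rightarrow> 'b) \<Rightarrow> (nat \<Rightarrow> 'v node) \<Rightarrow> nat \<Rightarrow> 'b list" where
  "bu f l 0 = []"
| "bu f l (Suc n) = bu f l n @ [f (\<lambda>c. bu f l n ! c) (l n)]"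

definition at_node :: "((nat \<Rightarrow> 'b) \<Rightarrow> 'v node \<Rightarrow> 'b) \<Rightarrow> (nat \<Rightarrow> 'v node) \<Rightarrow> nat \<Rightarrow> 'b" where
  "at_node f l v = bu f l (Suc v) ! v"

text \<open>Partial assignments in {0,1,*}^N: None encodes *.\<close>
fun evalnode :: "('v \<Rightarrow> bool option) \<Rightarrow> (nat \<Rightarrow> real) \<Rightarrow> 'v node \<Rightarrow> real" where
  "evalnode a r (Leaf x b) = (case a x of None \<Rightarrow> 1 | Some c \<Rightarrow> (if c = b then 1 else 0))"
| "evalnode a r (SumN ws) = (\<Sum>(w, c) \<leftarrow> ws. w * r c)"
| "evalnode a r (ProdN cs) = (\<Prod>c \<leftarrow> cs. r c)"
| "evalnode a r (QuotN n d) = r n / r d"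

fun scnode :: "(nat \<Rightarrow> 'v set) \<Rightarrow> 'v node \<Rightarrow> 'v set" where
  "scnode r (Leaf x b) = {x}"
| "scnode r (SumN ws) = (\<Union>c \<in> set (map snd ws). r c)"
| "scnode r (ProdN cs) = (\<Union>c \<in> set cs. r c)"
| "scnode r (QuotN n d) = r n \<union> r d"

fun effnode :: "(nat \<Rightarrow> 'v set) \<Rightarrow> 'v node \<Rightarrow> 'v set" where
  "effnode r (Leaf x b) = {x}"
| "effnode r (SumN ws) = (\<Union>c \<in> set (map snd ws). r c)"
| "effnode r (ProdN cs) = (\<Union>c \<in> set cs. r c)"
| "effnode r (QuotN n d) = r n - r d"

definition Psi :: "'v spqn \<Rightarrow> ('v \<Rightarrow> bool option) \<Rightarrow> nat \<Rightarrow> real" where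
  "Psi G a v = at_node (evalnode a) (lab G) v"

definition sc :: "'v spqn \<Rightarrow> nat \<Rightarrow> 'v set" where
  "sc G v = at_node scnode (lab G) v"

definition eff :: "'v spqn \<Rightarrow> nat \<Rightarrow> 'v set" where
  "eff G v = at_node effnode (lab G) v"

definition cond :: "'v spqn \<Rightarrow> nat \<Rightarrow> 'v set" where
  "cond G v = sc G v - eff G v"

definition wf_spqn :: "'v spqn \<Rightarrow> bool" where
  "wf_spqn G \<longleftrightarrow> root G < nnodes G \<and>
     (\<forall>v < nnodes G. \<forall>c \<in> set (children (lab G v)). c < v) \<and>
     (\<forall>v < nnodes G. \<forall>ws. lab G v = SumN ws \<longrightarrow>
         (\<forall>(w, c) \<in> set ws. w > 0) \<and> sum_list (map fst ws) = 1)"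

definition over_vars :: "'v spqn \<Rightarrow> 'v set \<Rightarrow> bool" where
  "over_vars G V \<longleftrightarrow> (\<forall>v < nnodes G. \<forall>x b. lab G v = Leaf x b \<longrightarrow> x \<in> V)"

definition spqn_size :: "'v spqn \<Rightarrow> nat" where
  "spqn_size G = card {v. v < nnodes G \<and> \<not> is_leaf (lab G v)}"

definition cc_sum :: "'v spqn \<Rightarrow> nat \<Rightarrow> bool" where
  "cc_sum G v \<longleftrightarrow> (\<forall>ws. lab G v = SumN ws \<longrightarrow>
     (\<forall>c \<in> set (map snd ws). \<forall>c' \<in> set (map snd ws). eff G c = eff G c'))"

definition cd_prod :: "'v spqn \<Rightarrow> nat \<Rightarrow> bool" where
  "cd_prod G v \<longleftrightarrow> (\<forall>cs. lab G v = ProdN cs \<longrightarrow>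
     (\<forall>i < length cs. \<forall>j < length cs. i \<noteq> j \<longrightarrow> eff G (cs ! i) \<inter> eff G (cs ! j) = {}) \<and>
     acyclic {(c', c''). c' \<in> set cs \<and> c'' \<in> set cs \<and> eff G c' \<inter> cond G c'' \<noteq> {}})"

definition cond_complete :: "'v spqn \<Rightarrow> bool" where
  "cond_complete G \<longleftrightarrow> (\<forall>v < nnodes G. cc_sum G v)"

definition cond_decomposable :: "'v spqn \<Rightarrow> bool" where
  "cond_decomposable G \<longleftrightarrow> (\<forall>v < nnodes G. cd_prod G v)"

definition cond_sound :: "'v spqn \<Rightarrow> bool" where
  "cond_sound G \<longleftrightarrow> (\<forall>v < nnodes G. \<forall>nu de. lab G v = QuotN nu de \<longrightarrow>
     (\<forall>a. Psi G a de > 0) \<and> cond G de \<subseteq> cond G nu \<and> eff G de \<subseteq> eff G nu \<and>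
     (\<forall>a. Psi G a de =
        (\<Sum>S \<in> Pow (eff G v). Psi G (\<lambda>i. if i \<in> eff G v then Some (i \<in> S) else a i) nu)))"

text \<open>Node v is a CMO node with parameters alpha, beta, gamma, weights w (indexed
  0..<gamma) and children a i j, b i j (0-based indices), with its internal nodes,
  and the internal conditions (2)-(4) of validity hold.\<close>
definition cmo_node :: "'v spqn \<Rightarrow> nat \<Rightarrow> nat \<Rightarrow> nat \<Rightarrow> nat \<Rightarrow> (nat \<Rightarrow> real)
    \<Rightarrow> (nat \<Rightarrow> nat \<Rightarrow> nat) \<Rightarrow> (nat \<Rightarrow> nat \<Rightarrow> nat) \<Rightarrow> bool" where
  "cmo_node G v \<alpha> \<beta> \<gamma> w a b \<longleftrightarrow> \<beta> > 0 \<and> \<gamma> \<ge> 1 \<and> (\<forall>i < \<gamma>. w i > 0) \<and> (\<Sum>i < \<gamma>. w i) = 1 \<and>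
    (\<exists>nu de p PA PB.
       lab G v = QuotN nu de \<and>
       lab G nu = SumN (map (\<lambda>i. (w i, p i)) [0..<\<gamma>]) \<and>
       lab G de = SumN (map (\<lambda>i. (w i, PA i)) [0..<\<gamma>]) \<and>
       (\<forall>i < \<gamma>. lab G (p i) = ProdN [PA i, PB i] \<and>
                 lab G (PA i) = ProdN (map (a i) [0..<\<alpha>]) \<and>
                 lab G (PB i) = ProdN (map (b i) [0..<\<beta>])) \<and>
       \<comment> \<open>(2) internal sum nodes conditionally complete\<close>
       cc_sum G nu \<and> cc_sum G de \<and>
       \<comment> \<open>(3) internal product nodes conditionally decomposable, no edge P^B_i \<rightarrow> P^A_i\<close>
       (\<forall>i < \<gamma>. cd_prod G (PA i) \<and> cd_prod G (PB i) \<and> cd_prod G (p i) \<and>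
                 eff G (PB i) \<inter> cond G (PA i) = {}) \<and>
       \<comment> \<open>(4) equal effective scopes of the P^B_i\<close>
       (\<forall>i1 < \<gamma>. \<forall>i2 < \<gamma>. eff G (PB i1) = eff G (PB i2)))"

inductive valid_cmo :: "'v spqn \<Rightarrow> nat \<Rightarrow> bool" for G where
  base: "\<lbrakk> cmo_node G v 0 1 2 w a b;
           (lab G (b 0 0) = Leaf x False \<and> lab G (b 1 0) = Leaf x True) \<or>
           (lab G (b 0 0) = Leaf x True \<and> lab G (b 1 0) = Leaf x False) \<rbrakk>
         \<Longrightarrow> valid_cmo G v"
| step: "\<lbrakk> cmo_node G v \<alpha> \<beta> \<gamma> w a b;
           \<forall>i < \<gamma>. \<forall>j < \<alpha>. valid_cmo G (a i j);
           \<forall>i < \<gamma>. \<forall>j < \<beta>. valid_cmo G (b i j) \<rbrakk>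
         \<Longrightarrow> valid_cmo G v"

definition cmo_composed :: "'v spqn \<Rightarrow> bool" where
  "cmo_composed G \<longleftrightarrow> valid_cmo G (root G)"

definition edgevars :: "nat \<Rightarrow> (nat \<times> nat) set" where
  "edgevars M = {(i, j). i < j \<and> j < M}"

definition has_triangle :: "(nat \<times> nat) set \<Rightarrow> bool" where
  "has_triangle S \<longleftrightarrow> (\<exists>i1 i2 i3. i1 < i2 \<and> i2 < i3 \<and>
      (i1, i2) \<in> S \<and> (i2, i3) \<in> S \<and> (i1, i3) \<in> S)"

definition graph_asg :: "nat \<Rightarrow> (nat \<times> nat) set \<Rightarrow> (nat \<times> nat \<Rightarrow> bool option)" where
  "graph_asg M S = (\<lambda>e. if e \<in> edgevars M then Some (e \<in> S) else None)"

definition tf_dist :: "nat \<Rightarrow> ((nat \<times> nat) set \<Rightarrow> real) \<Rightarrow> bool" where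
  "tf_dist M d \<longleftrightarrow> (\<forall>S \<subseteq> edgevars M. d S \<ge> 0) \<and>
     (\<Sum>S \<in> Pow (edgevars M). d S) = 1 \<and>
     (\<forall>S \<subseteq> edgevars M. d S > 0 \<longleftrightarrow> \<not> has_triangle S)"

end

theory Submission
  imports Defs
begin

text \<open>
  Sample the edges in lexicographic order: edge (i, j) must be absent if some earlier pair
  (k, i), (k, j) with k < i is present, and has
  positive probability otherwise. The conditional distribution of
  (i, j) is a single CMO node that mixes two components: one whose context factor is a product
  over k of factors vanishing exactly when (k, i) and (k, j) are both present, paired with a fair
  coin for (i, j), and one with a strictly positive context factor, paired with the constant 0 for
  (i, j). Their product over all edges is the required distribution, because a triangle
  k < i < j is detected at its last edge (i, j); the network has O(M^3) nodes.

  The constant 0 is a leaf of a general SPQN, but it is not a valid CMO node; there it is replaced by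
  a coin of bias \<open>\<epsilon> > 0\<close>, and \<open>\<epsilon> \<longrightarrow> 0\<close> gives the approximating sequence.
  Both networks are the instances \<open>\<epsilon> = 0\<close> and \<open>\<epsilon> > 0\<close> of one construction.
\<close>

section \<open>Bottom-up evaluation and topological numberings\<close>

lemma length_bu [simp]: "length (bu f l n) = n"
  by (induction n) auto

lemma nth_bu: "c < n \<Longrightarrow> bu f l n ! c = at_node f l c"
proof (induction n)
  case (Suc n)
  then show ?case
    by (cases "c = n") (auto simp: at_node_def nth_append)
qed simp

lemma at_node_unfold: "at_node f l v = f (\<lambda>c. bu f l v ! c) (l v)"
  by (simp add: at_node_def nth_append)

text \<open>Strong induction on \<open>idx n\<close>: when node \<open>v\<close> is processed, every
  earlier position of the list already holds its final value. A closed form \<open>t\<close> on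
  names therefore only has to satisfy the one-step recursion. Values, scopes and effective scopes of
  the network are all computed this way.\<close>

lemma at_node_eqI:
  assumes "\<And>n r. n \<in> K \<Longrightarrow> (\<And>n'. n' \<in> K \<Longrightarrow> idx n' < idx n \<Longrightarrow> r (idx n') = t n')
             \<Longrightarrow> f r (l (idx n)) = t n"
    and "n \<in> K"
  shows "at_node f l (idx n) = t n"
  using assms(2)
proof (induction "idx n" arbitrary: n rule: less_induct)
  case less
  show ?case
    unfolding at_node_unfold by (rule assms(1)) (auto simp: nth_bu less)
qed

text \<open>Take \<open>rank x * n + f x\<close>, where \<open>f\<close> enumerates the
  \<open>n\<close> elements of \<open>K\<close> below \<open>n\<close>: the remainder modulo
  \<open>n\<close> recovers \<open>f x\<close>, which gives injectivity, and a larger rank outweighs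
  any value of \<open>f\<close>. The numbers may have gaps.\<close>

lemma exists_topological_numbering:
  fixes rank :: "'n \<Rightarrow> nat"
  assumes "finite K"
  shows "\<exists>idx :: 'n \<Rightarrow> nat. \<exists>m. inj_on idx K \<and> (\<forall>x \<in> K. idx x < m) \<and>
           (\<forall>x \<in> K. \<forall>y \<in> K. rank x < rank y \<longrightarrow> idx x < idx y)"
proof -
  obtain f and n :: nat where f: "f ` K = {i. i < n}" "inj_on f K"
    using finite_imp_inj_to_nat_seg[OF assms] by blast
  have lt: "f x < n" if "x \<in> K" for x
    using f(1) that by blast
  define idx where "idx x = rank x * n + f x" for x
  have mod: "idx x mod n = f x" if "x \<in> K" for x
    using lt[OF that] by (simp add: idx_def)
  have "inj_on idx K"
    by (rule inj_onI) (metis f(2) inj_onD mod)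
  moreover have "idx x < idx y" if "x \<in> K" "y \<in> K" "rank x < rank y" for x y
  proof -
    have "idx x < Suc (rank x) * n"
      using lt[OF that(1)] by (simp add: idx_def)
    also have "\<dots> \<le> rank y * n"
      using that(3) by (intro mult_le_mono1) simp
    also have "\<dots> \<le> idx y"
      by (simp add: idx_def)
    finally show ?thesis .
  qed
  moreover have "\<forall>x \<in> K. idx x < Suc (Max (idx ` K))"
    using assms by (simp add: le_imp_less_Suc)
  ultimately show ?thesis by blast
qed

section \<open>Chain rule for products of local conditionals\<close>

lemma sum_Pow_insert:
  assumes "finite A" "x \<notin> A"
  shows "(\<Sum>S \<in> Pow (insert x A). f S) = (\<Sum>S \<in> Pow A. f S + f (insert x S))"
proof -
  have inj: "inj_on (insert x) (Pow A)"
  proof (rule inj_onI)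
    fix S T assume "S \<in> Pow A" "T \<in> Pow A" and eq: "insert x S = insert x T"
    then have "x \<notin> S" "x \<notin> T" using assms(2) by blast+
    with eq show "S = T" by (simp add: insert_ident)
  qed
  have "Pow A \<inter> insert x ` Pow A = {}"
    using assms(2) by blast
  then have "(\<Sum>S \<in> Pow (insert x A). f S) = sum f (Pow A) + sum f (insert x ` Pow A)"
    using assms(1) by (simp add: Pow_insert sum.union_disjoint)
  then show ?thesis
    by (simp add: sum.reindex[OF inj] sum.distrib)
qed

text \<open>Elements are inserted in order of nondecreasing \<open>m\<close>. The newest element
  \<open>x\<close> has maximal rank, so no other factor depends on whether \<open>x\<close> is in
  \<open>S\<close>; summing over that choice turns the factor of \<open>x\<close> into 1 and leaves
  the sum for the smaller set. Elements of equal rank must ignore each other, which the strict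
  inequality in \<open>local\<close> expresses.\<close>

lemma sum_prod_conditionals_eq_1:
  fixes g :: "'a \<Rightarrow> 'a set \<Rightarrow> real" and m :: "'a \<Rightarrow> nat"
  assumes "finite E"
    and local: "\<And>e S T. e \<in> E \<Longrightarrow> (e \<in> S \<longleftrightarrow> e \<in> T) \<Longrightarrow>
                  (\<And>e'. m e' < m e \<Longrightarrow> e' \<in> S \<longleftrightarrow> e' \<in> T) \<Longrightarrow> g e S = g e T"
    and norm: "\<And>e S. e \<in> E \<Longrightarrow> e \<notin> S \<Longrightarrow> g e S + g e (insert e S) = 1"
  shows "(\<Sum>S \<in> Pow E. \<Prod>e \<in> E. g e S) = 1"
  using assms
proof (induction E rule: finite_ranking_induct[where f = m])
  case (insert x E)
  have IH: "(\<Sum>S \<in> Pow E. \<Prod>e \<in> E. g e S) = 1"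
  proof (rule insert.IH)
    show "g e S = g e T" if "e \<in> E" "e \<in> S \<longleftrightarrow> e \<in> T"
      "\<And>e'. m e' < m e \<Longrightarrow> e' \<in> S \<longleftrightarrow> e' \<in> T" for e S T
      by (rule insert.prems(1)[OF insertI2[OF that(1)] that(2,3)])
    show "g e S + g e (insert e S) = 1" if "e \<in> E" "e \<notin> S" for e S
      by (rule insert.prems(2)[OF insertI2[OF that(1)] that(2)])
  qed
  show ?case
  proof (cases "x \<in> E")
    case True
    then show ?thesis using IH by (simp add: insert_absorb)
  next
    case False
    have "(\<Sum>S \<in> Pow (insert x E). \<Prod>e \<in> insert x E. g e S) =
          (\<Sum>S \<in> Pow E. (g x S + g x (insert x S)) * (\<Prod>e \<in> E. g e S))"
      unfolding sum_Pow_insert[OF insert.hyps(1) False]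
    proof (rule sum.cong[OF refl])
      fix S assume "S \<in> Pow E"
      have "(\<Prod>e \<in> E. g e (insert x S)) = (\<Prod>e \<in> E. g e S)"
      proof (rule prod.cong[OF refl])
        fix e assume "e \<in> E"
        then show "g e (insert x S) = g e S"
          using False insert.hyps(2)[of e] by (intro insert.prems(1)) auto
      qed
      then show "(\<Prod>e \<in> insert x E. g e S) + (\<Prod>e \<in> insert x E. g e (insert x S)) =
          (g x S + g x (insert x S)) * (\<Prod>e \<in> E. g e S)"
        using insert.hyps(1) False by (simp add: algebra_simps)
    qed
    also have "\<dots> = (\<Sum>S \<in> Pow E. \<Prod>e \<in> E. g e S)"
      using False by (intro sum.cong refl) (subst insert.prems(2), auto)
    also have "\<dots> = 1"
      by (rule IH)
    finally show ?thesis .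
  qed
qed simp

section \<open>Criteria for decomposable products and CMO nodes\<close>

lemma acyclic_no_cond:
  assumes "\<And>c. c \<in> set cs \<Longrightarrow> cond G c = {}"
  shows "acyclic {(c', c''). c' \<in> set cs \<and> c'' \<in> set cs \<and> eff G c' \<inter> cond G c'' \<noteq> {}}"
proof -
  have none: "{(c', c''). c' \<in> set cs \<and> c'' \<in> set cs \<and> eff G c' \<inter> cond G c'' \<noteq> {}} = {}"
    using assms by auto
  show ?thesis unfolding none by (simp add: acyclic_def)
qed

lemma cd_prodI:
  assumes "lab G v = ProdN cs"
    and "\<And>i j. i < j \<Longrightarrow> j < length cs \<Longrightarrow> eff G (cs ! i) \<inter> eff G (cs ! j) = {}"
    and "acyclic {(c', c''). c' \<in> set cs \<and> c'' \<in> set cs \<and> eff G c' \<inter> cond G c'' \<noteq> {}}"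
  shows "cd_prod G v"
  unfolding cd_prod_def
proof (intro allI impI conjI)
  fix cs' i j assume "lab G v = ProdN cs'" and ij: "i < length cs'" "j < length cs'" "i \<noteq> j"
  then have [simp]: "cs' = cs" using assms(1) by simp
  show "eff G (cs' ! i) \<inter> eff G (cs' ! j) = {}"
    using assms(2)[of i j] assms(2)[of j i] ij by (cases "i < j") auto
qed (use assms in simp)

lemma cmo_nodeI:
  assumes "\<beta> > 0" "\<gamma> \<ge> 1" "\<And>i. i < \<gamma> \<Longrightarrow> w i > 0" "(\<Sum>i < \<gamma>. w i) = 1"
    and "lab G v = QuotN nu de"
    and "lab G nu = SumN (map (\<lambda>i. (w i, p i)) [0..<\<gamma>])"
    and "lab G de = SumN (map (\<lambda>i. (w i, PA i)) [0..<\<gamma>])"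
    and "\<And>i. i < \<gamma> \<Longrightarrow> lab G (p i) = ProdN [PA i, PB i]"
    and "\<And>i. i < \<gamma> \<Longrightarrow> lab G (PA i) = ProdN (map (a i) [0..<\<alpha>])"
    and "\<And>i. i < \<gamma> \<Longrightarrow> lab G (PB i) = ProdN (map (b i) [0..<\<beta>])"
    and "cc_sum G nu" "cc_sum G de"
    and "\<And>i. i < \<gamma> \<Longrightarrow> cd_prod G (PA i) \<and> cd_prod G (PB i) \<and> cd_prod G (p i)"
    and "\<And>i. i < \<gamma> \<Longrightarrow> eff G (PB i) \<inter> cond G (PA i) = {}"
    and "\<And>i. i < \<gamma> \<Longrightarrow> eff G (PB i) = X"
  shows "cmo_node G v \<alpha> \<beta> \<gamma> w a b"
  unfolding cmo_node_def
  by (intro conjI; (rule exI[of _ nu], rule exI[of _ de], rule exI[of _ p],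
        rule exI[of _ PA], rule exI[of _ PB])?)
     (use assms in simp_all)

section \<open>The network\<close>

text \<open>\<open>Coin True\<close> has bias \<open>\<epsilon>\<close> and \<open>Coin False\<close> is fair; \<open>Wedge b k i j\<close> is the context factor on
  the edges (k, i), (k, j), and for \<open>b = True\<close>, \<open>\<epsilon> = 0\<close> it vanishes when both are present.
  \<open>Slot i j\<close> is the conditional of the edge (i, j).
  Every CMO node has \<open>\<gamma> = 2\<close> components, indexed by a Boolean; those of \<open>Top\<close> coincide.\<close>

datatype cmo_id = Coin bool "nat \<times> nat" | Wedge bool nat nat nat | Slot nat nat | Top

text \<open>Nodes are named first and numbered afterwards. Besides the leaves there is one name for
  each part of a CMO node: the quotient, its numerator and denominator sums, and, for each
  component, the products p_i (\<open>Mix\<close>), P^A_i and P^B_i.\<close>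

datatype name = Lf "nat \<times> nat" bool | Quo cmo_id | Num cmo_id | Den cmo_id
  | Mix cmo_id bool | PA cmo_id bool | PB cmo_id bool

fun id_rank :: "cmo_id \<Rightarrow> nat" where
  "id_rank (Coin _ _) = 1"
| "id_rank (Wedge _ _ _ _) = 2"
| "id_rank (Slot _ _) = 3"
| "id_rank Top = 4"

text \<open>Each CMO node occupies four consecutive layers: products, mixed products, sums,
  quotient. A quotient of id rank r - 1 sits at 4 * (r - 1) + 3, just below the first layer 4 * r of
  its users; id ranks start at 1 so that layer 0 is left to the leaves.\<close>

fun name_rank :: "name \<Rightarrow> nat" where
  "name_rank (Lf _ _) = 0"
| "name_rank (PA c _) = 4 * id_rank c"
| "name_rank (PB c _) = 4 * id_rank c"
| "name_rank (Mix c _) = 4 * id_rank c + 1"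
| "name_rank (Num c) = 4 * id_rank c + 2"
| "name_rank (Den c) = 4 * id_rank c + 2"
| "name_rank (Quo c) = 4 * id_rank c + 3"

fun valid_id :: "nat \<Rightarrow> cmo_id \<Rightarrow> bool" where
  "valid_id M (Coin b e) \<longleftrightarrow> e \<in> edgevars M"
| "valid_id M (Wedge b k i j) \<longleftrightarrow> k < i \<and> i < j \<and> j < M"
| "valid_id M (Slot i j) \<longleftrightarrow> i < j \<and> j < M"
| "valid_id M Top \<longleftrightarrow> True"

fun valid_name :: "nat \<Rightarrow> name \<Rightarrow> bool" where
  "valid_name M (Lf e b) \<longleftrightarrow> e \<in> edgevars M"
| "valid_name M (PA c _) \<longleftrightarrow> valid_id M c"
| "valid_name M (PB c _) \<longleftrightarrow> valid_id M c"
| "valid_name M (Mix c _) \<longleftrightarrow> valid_id M c"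
| "valid_name M (Num c) \<longleftrightarrow> valid_id M c"
| "valid_name M (Den c) \<longleftrightarrow> valid_id M c"
| "valid_name M (Quo c) \<longleftrightarrow> valid_id M c"

definition names :: "nat \<Rightarrow> name set" where
  "names M = {n. valid_name M n}"

fun inner_names :: "cmo_id \<Rightarrow> name set" where
  "inner_names c = {Quo c, Num c, Den c, Mix c True, Mix c False,
     PA c True, PA c False, PB c True, PB c False}"

section \<open>Counting the nodes\<close>

lemma finite_edgevars [simp]: "finite (edgevars M)"
  by (rule finite_subset[of _ "{..<M} \<times> {..<M}"]) (auto simp: edgevars_def)

lemma card_valid_ids: "finite {c. valid_id M c}" "card {c. valid_id M c} \<le> 6 * M ^ 3 + 1"
proof -
  let ?D = "(UNIV :: bool set) \<times> {..<M} \<times> {..<M} \<times> {..<M} \<times> {..<3::nat}"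
  define f where "f = (\<lambda>(b, k, i, j, t). if t = 0 then Coin b (i, j)
     else if t = (1::nat) then Wedge b k i j else Slot i j)"
  have sub: "{c. valid_id M c} \<subseteq> insert Top (f ` ?D)"
  proof
    fix c assume "c \<in> {c. valid_id M c}"
    then show "c \<in> insert Top (f ` ?D)"
    proof (cases c)
      case (Coin b e)
      then show ?thesis using \<open>c \<in> _\<close>
        by (intro insertI2 image_eqI[where x = "(b, fst e, fst e, snd e, 0)"])
           (auto simp: f_def edgevars_def)
    next
      case (Wedge b k i j)
      then show ?thesis using \<open>c \<in> _\<close>
        by (intro insertI2 image_eqI[where x = "(b, k, i, j, 1)"]) (auto simp: f_def)
    next
      case (Slot i j)
      then show ?thesis using \<open>c \<in> _\<close>
        by (intro insertI2 image_eqI[where x = "(True, i, i, j, 2)"]) (auto simp: f_def)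
    qed simp
  qed
  have fin: "finite (insert Top (f ` ?D))" by simp
  show "finite {c. valid_id M c}"
    by (rule finite_subset[OF sub fin])
  have "card {c. valid_id M c} \<le> card (insert Top (f ` ?D))"
    by (rule card_mono[OF fin sub])
  also have "\<dots> \<le> Suc (card (f ` ?D))"
    by (rule card_insert_le_m1) simp_all
  also have "\<dots> \<le> Suc (card ?D)"
    by (rule Suc_leI[OF le_imp_less_Suc[OF card_image_le]]) simp
  also have "\<dots> \<le> 6 * M ^ 3 + 1"
    by (simp add: card_cartesian_product power3_eq_cube)
  finally show "card {c. valid_id M c} \<le> 6 * M ^ 3 + 1" .
qed

lemma names_cases:
  assumes "n \<in> names M"
  obtains (leaf) e b where "n = Lf e b" "e \<in> edgevars M"
    | (inner) c where "valid_id M c" "n \<in> inner_names c"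
proof (cases n)
  case (Lf e b)
  then show ?thesis using assms leaf by (simp add: names_def)
next
  case (Quo c)
  then show ?thesis using assms inner[of c] by (simp add: names_def)
next
  case (Num c)
  then show ?thesis using assms inner[of c] by (simp add: names_def)
next
  case (Den c)
  then show ?thesis using assms inner[of c] by (simp add: names_def)
next
  case (Mix c s)
  then show ?thesis using assms inner[of c] by (simp add: names_def)
next
  case (PA c s)
  then show ?thesis using assms inner[of c] by (simp add: names_def)
next
  case (PB c s)
  then show ?thesis using assms inner[of c] by (simp add: names_def)
qed

lemma finite_names: "finite (names M)"
proof (rule finite_subset)
  show "names M \<subseteq> (\<lambda>(e, b). Lf e b) ` (edgevars M \<times> UNIV) \<union> (\<Union>c \<in> {c. valid_id M c}. inner_names c)"
  proof
    fix n assume "n \<in> names M"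
    then show "n \<in> (\<lambda>(e, b). Lf e b) ` (edgevars M \<times> UNIV) \<union> (\<Union>c \<in> {c. valid_id M c}. inner_names c)"
    proof (cases rule: names_cases)
      case (leaf e b)
      then show ?thesis by (intro UnI1 image_eqI[where x = "(e, b)"]) auto
    qed blast
  qed
  show "finite ((\<lambda>(e, b). Lf e b) ` (edgevars M \<times> UNIV) \<union> (\<Union>c \<in> {c. valid_id M c}. inner_names c))"
    using card_valid_ids(1) by simp
qed

lemma card_inner_names:
  "card (\<Union>c \<in> {c. valid_id M c}. inner_names c) \<le> 9 * (6 * M ^ 3 + 1)"
proof -
  have "card (inner_names c) \<le> 9" for c
    using card_length[of "[Quo c, Num c, Den c, Mix c True, Mix c False,
     PA c True, PA c False, PB c True, PB c False]"] by simp
  then have "(\<Sum>c \<in> {c. valid_id M c}. card (inner_names c)) \<le> of_nat (card {c. valid_id M c}) * 9"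
    by (rule sum_bounded_above)
  also have "\<dots> \<le> (6 * M ^ 3 + 1) * 9"
    using card_valid_ids(2)[of M] by simp
  finally show ?thesis
    using card_UN_le[OF card_valid_ids(1), of inner_names M] by simp
qed

section \<open>Children, weights and closed forms of values and scopes\<close>

definition edge_list :: "nat \<Rightarrow> (nat \<times> nat) list" where
  "edge_list M = filter (\<lambda>(i, j). i < j) (List.product [0..<M] [0..<M])"

lemma distinct_edge_list: "distinct (edge_list M)"
  by (simp add: edge_list_def distinct_product)

lemma set_edge_list [simp]: "set (edge_list M) = edgevars M"
  by (auto simp: edge_list_def edgevars_def)

definition bias :: "real \<Rightarrow> bool \<Rightarrow> real" where
  "bias \<epsilon> b = (if b then \<epsilon> else 1/2)"

text \<open>For \<open>\<epsilon> = 0\<close> the biased coins are replaced by leaves. The nodes named \<open>Coin True\<close> still exist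
  but are not used; their weights are set to 1/2 to stay strictly positive.\<close>

fun coin_name :: "real \<Rightarrow> bool \<Rightarrow> nat \<times> nat \<Rightarrow> name" where
  "coin_name \<epsilon> b e = (if b \<and> \<epsilon> = 0 then Lf e False else Quo (Coin b e))"

fun weight :: "real \<Rightarrow> cmo_id \<Rightarrow> bool \<Rightarrow> real" where
  "weight \<epsilon> (Coin b e) s =
     (if b \<and> \<epsilon> = 0 then 1/2 else if s then bias \<epsilon> b else 1 - bias \<epsilon> b)"
| "weight \<epsilon> _ s = 1/2"

fun a_names :: "cmo_id \<Rightarrow> bool \<Rightarrow> name list" where
  "a_names (Slot i j) s = map (\<lambda>k. Quo (Wedge s k i j)) [0..<i]"
| "a_names _ s = []"

text \<open>"Not both edges present" is no single product of coins, so a wedge mixes two: the biased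
  coin falls on (k, i) in one component and on (k, j) in the other. At \<open>\<epsilon> = 0\<close>
  the first requires (k, i) to be absent, the second (k, j), and both vanish only if both edges are
  present. In a slot, \<open>s = True\<close> pairs the restrictive context with a fair coin, and
  \<open>s = False\<close> the positive context with the biased coin.\<close>

fun b_names :: "nat \<Rightarrow> real \<Rightarrow> cmo_id \<Rightarrow> bool \<Rightarrow> name list" where
  "b_names M \<epsilon> (Coin b e) s = [Lf e s]"
| "b_names M \<epsilon> (Wedge b k i j) s =
     [coin_name \<epsilon> (b \<and> \<not> s) (k, i), coin_name \<epsilon> (b \<and> s) (k, j)]"
| "b_names M \<epsilon> (Slot i j) s = [coin_name \<epsilon> (\<not> s) (i, j)]"
| "b_names M \<epsilon> Top s = map (\<lambda>(i, j). Quo (Slot i j)) (edge_list M)"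

fun label :: "nat \<Rightarrow> real \<Rightarrow> (name \<Rightarrow> nat) \<Rightarrow> name \<Rightarrow> (nat \<times> nat) node" where
  "label M \<epsilon> idx (Lf e b) = Leaf e b"
| "label M \<epsilon> idx (PA c s) = ProdN (map idx (a_names c s))"
| "label M \<epsilon> idx (PB c s) = ProdN (map idx (b_names M \<epsilon> c s))"
| "label M \<epsilon> idx (Mix c s) = ProdN [idx (PA c s), idx (PB c s)]"
| "label M \<epsilon> idx (Num c) =
     SumN [(weight \<epsilon> c False, idx (Mix c False)), (weight \<epsilon> c True, idx (Mix c True))]"
| "label M \<epsilon> idx (Den c) =
     SumN [(weight \<epsilon> c False, idx (PA c False)), (weight \<epsilon> c True, idx (PA c True))]"
| "label M \<epsilon> idx (Quo c) = QuotN (idx (Num c)) (idx (Den c))"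

text \<open>A Bernoulli variable that takes its total mass 1 at an unassigned argument. The
  parameters 0 and 1 give the two indicator leaves, so leaves and coins share one closed
  form.\<close>

definition coin :: "real \<Rightarrow> bool option \<Rightarrow> real" where
  "coin p x = (case x of None \<Rightarrow> 1 | Some b \<Rightarrow> if b then p else 1 - p)"

text \<open>At \<open>p = 1/2\<close> this is the product of two fair coins, hence positive; at
  \<open>p = 0\<close> it vanishes exactly when both edges are assigned present.\<close>

definition wedge_val :: "real \<Rightarrow> (nat \<times> nat \<Rightarrow> bool option) \<Rightarrow> nat \<Rightarrow> nat \<Rightarrow> nat \<Rightarrow> real" where
  "wedge_val p a k i j =
     (coin p (a (k, i)) * coin (1/2) (a (k, j)) + coin (1/2) (a (k, i)) * coin p (a (k, j))) / 2"

definition slot_num :: "real \<Rightarrow> (nat \<times> nat \<Rightarrow> bool option) \<Rightarrow> nat \<Rightarrow> nat \<Rightarrow> real" where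
  "slot_num \<epsilon> a i j =
     ((\<Prod>k<i. wedge_val (1/2) a k i j) * coin \<epsilon> (a (i, j)) +
      (\<Prod>k<i. wedge_val \<epsilon> a k i j) * coin (1/2) (a (i, j))) / 2"

definition slot_den :: "real \<Rightarrow> (nat \<times> nat \<Rightarrow> bool option) \<Rightarrow> nat \<Rightarrow> nat \<Rightarrow> real" where
  "slot_den \<epsilon> a i j = ((\<Prod>k<i. wedge_val (1/2) a k i j) + (\<Prod>k<i. wedge_val \<epsilon> a k i j)) / 2"

definition slot_val :: "real \<Rightarrow> (nat \<times> nat \<Rightarrow> bool option) \<Rightarrow> nat \<Rightarrow> nat \<Rightarrow> real" where
  "slot_val \<epsilon> a i j = slot_num \<epsilon> a i j / slot_den \<epsilon> a i j"

definition top_val :: "nat \<Rightarrow> real \<Rightarrow> (nat \<times> nat \<Rightarrow> bool option) \<Rightarrow> real" where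
  "top_val M \<epsilon> a = (\<Prod>(i, j) \<in> edgevars M. slot_val \<epsilon> a i j)"

fun pa_val :: "real \<Rightarrow> (nat \<times> nat \<Rightarrow> bool option) \<Rightarrow> cmo_id \<Rightarrow> bool \<Rightarrow> real" where
  "pa_val \<epsilon> a (Slot i j) s = (\<Prod>k<i. wedge_val (bias \<epsilon> s) a k i j)"
| "pa_val \<epsilon> a _ s = 1"

fun pb_val :: "nat \<Rightarrow> real \<Rightarrow> (nat \<times> nat \<Rightarrow> bool option) \<Rightarrow> cmo_id \<Rightarrow> bool \<Rightarrow> real" where
  "pb_val M \<epsilon> a (Coin b e) s = coin (of_bool s) (a e)"
| "pb_val M \<epsilon> a (Wedge b k i j) s =
     coin (bias \<epsilon> (b \<and> \<not> s)) (a (k, i)) * coin (bias \<epsilon> (b \<and> s)) (a (k, j))"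
| "pb_val M \<epsilon> a (Slot i j) s = coin (bias \<epsilon> (\<not> s)) (a (i, j))"
| "pb_val M \<epsilon> a Top s = top_val M \<epsilon> a"

definition num_val :: "nat \<Rightarrow> real \<Rightarrow> (nat \<times> nat \<Rightarrow> bool option) \<Rightarrow> cmo_id \<Rightarrow> real" where
  "num_val M \<epsilon> a c = weight \<epsilon> c False * (pa_val \<epsilon> a c False * pb_val M \<epsilon> a c False) +
     weight \<epsilon> c True * (pa_val \<epsilon> a c True * pb_val M \<epsilon> a c True)"

definition den_val :: "real \<Rightarrow> (nat \<times> nat \<Rightarrow> bool option) \<Rightarrow> cmo_id \<Rightarrow> real" where
  "den_val \<epsilon> a c = weight \<epsilon> c False * pa_val \<epsilon> a c False + weight \<epsilon> c True * pa_val \<epsilon> a c True"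

fun val :: "nat \<Rightarrow> real \<Rightarrow> (nat \<times> nat \<Rightarrow> bool option) \<Rightarrow> name \<Rightarrow> real" where
  "val M \<epsilon> a (Lf e b) = coin (of_bool b) (a e)"
| "val M \<epsilon> a (PA c s) = pa_val \<epsilon> a c s"
| "val M \<epsilon> a (PB c s) = pb_val M \<epsilon> a c s"
| "val M \<epsilon> a (Mix c s) = pa_val \<epsilon> a c s * pb_val M \<epsilon> a c s"
| "val M \<epsilon> a (Num c) = num_val M \<epsilon> a c"
| "val M \<epsilon> a (Den c) = den_val \<epsilon> a c"
| "val M \<epsilon> a (Quo c) = num_val M \<epsilon> a c / den_val \<epsilon> a c"

fun own_edges :: "nat \<Rightarrow> cmo_id \<Rightarrow> (nat \<times> nat) set" where
  "own_edges M (Coin b e) = {e}"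
| "own_edges M (Wedge b k i j) = {(k, i), (k, j)}"
| "own_edges M (Slot i j) = {(i, j)}"
| "own_edges M Top = edgevars M"

fun context_edges :: "cmo_id \<Rightarrow> (nat \<times> nat) set" where
  "context_edges (Slot i j) = (\<Union>k<i. {(k, i), (k, j)})"
| "context_edges _ = {}"

fun name_eff :: "nat \<Rightarrow> name \<Rightarrow> (nat \<times> nat) set" where
  "name_eff M (Lf e b) = {e}"
| "name_eff M (PA c s) = context_edges c"
| "name_eff M (PB c s) = own_edges M c"
| "name_eff M (Mix c s) = context_edges c \<union> own_edges M c"
| "name_eff M (Num c) = context_edges c \<union> own_edges M c"
| "name_eff M (Den c) = context_edges c"
| "name_eff M (Quo c) = own_edges M c"

text \<open>Scope and effective scope differ only at slot quotients, whose context is conditioned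
  on. In the product of all slots the contexts consist of edges owned by other slots, so nothing
  remains conditional there.\<close>

fun name_sc :: "nat \<Rightarrow> name \<Rightarrow> (nat \<times> nat) set" where
  "name_sc M (Quo c) = context_edges c \<union> own_edges M c"
| "name_sc M n = name_eff M n"

section \<open>Values of the CMO nodes: positivity and locality\<close>

lemma weight_sum: "weight \<epsilon> c False + weight \<epsilon> c True = 1"
  by (cases c) auto

lemma weight_pos: "0 \<le> \<epsilon> \<Longrightarrow> \<epsilon> < 1 \<Longrightarrow> weight \<epsilon> c s > 0"
  by (cases c) (auto simp: bias_def)

lemma val_coin_name [simp]: "val M \<epsilon> a (coin_name \<epsilon> b e) = coin (bias \<epsilon> b) (a e)"
  by (auto simp: num_val_def den_val_def coin_def bias_def split: option.split)

lemma val_Wedge [simp]: "val M \<epsilon> a (Quo (Wedge b k i j)) = wedge_val (bias \<epsilon> b) a k i j"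
  by (cases b) (auto simp: num_val_def den_val_def wedge_val_def bias_def)

lemma num_val_Slot: "num_val M \<epsilon> a (Slot i j) = slot_num \<epsilon> a i j"
  and den_val_Slot: "den_val \<epsilon> a (Slot i j) = slot_den \<epsilon> a i j"
  by (auto simp: num_val_def den_val_def slot_num_def slot_den_def bias_def add_divide_distrib)

lemma den_val_eq_1: "\<nexists>i j. c = Slot i j \<Longrightarrow> den_val \<epsilon> a c = 1"
  using weight_sum[of \<epsilon> c] by (cases c) (auto simp: den_val_def)

lemma val_Slot: "val M \<epsilon> a (Quo (Slot i j)) = slot_val \<epsilon> a i j"
  by (simp add: num_val_Slot den_val_Slot slot_val_def)

lemma val_Top: "val M \<epsilon> a (Quo Top) = top_val M \<epsilon> a"
  by (simp add: num_val_def den_val_def)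

lemma coin_nonneg: "0 \<le> p \<Longrightarrow> p \<le> 1 \<Longrightarrow> coin p x \<ge> 0"
  by (auto simp: coin_def split: option.split)

lemma coin_half_pos: "coin (1/2) x > 0"
  by (auto simp: coin_def split: option.split)

lemma wedge_val_nonneg: "0 \<le> p \<Longrightarrow> p \<le> 1 \<Longrightarrow> wedge_val p a k i j \<ge> 0"
  by (simp add: wedge_val_def coin_nonneg)

lemma wedge_val_half_pos: "wedge_val (1/2) a k i j > 0"
  by (simp add: wedge_val_def coin_half_pos)

text \<open>The component with fair wedges keeps the denominator positive even if
  \<open>\<epsilon> = 0\<close> and some factor of the other context vanishes.\<close>

lemma slot_den_pos: "0 \<le> \<epsilon> \<Longrightarrow> \<epsilon> \<le> 1 \<Longrightarrow> slot_den \<epsilon> a i j > 0"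
  by (auto simp: slot_den_def intro!: divide_pos_pos add_pos_nonneg prod_pos prod_nonneg
      wedge_val_half_pos wedge_val_nonneg)

lemma den_val_pos: "0 \<le> \<epsilon> \<Longrightarrow> \<epsilon> \<le> 1 \<Longrightarrow> den_val \<epsilon> a c > 0"
  using den_val_eq_1[of c \<epsilon> a] slot_den_pos[of \<epsilon> a] by (cases c) (auto simp: den_val_Slot)

text \<open>The context of slot (i, j) consists of edges (k, i) and (k, j) with k < i, all with
  first endpoint below i. This locality is what the chain rule consumes.\<close>

lemma prod_wedge_cong:
  assumes "\<And>e. fst e < i \<Longrightarrow> a e = a' e"
  shows "(\<Prod>k<i. wedge_val p a k i j) = (\<Prod>k<i. wedge_val p a' k i j)"
  using assms by (intro prod.cong) (auto simp: wedge_val_def)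

lemma slot_den_cong:
  assumes "\<And>e. fst e < i \<Longrightarrow> a e = a' e"
  shows "slot_den \<epsilon> a i j = slot_den \<epsilon> a' i j"
  by (simp add: slot_den_def prod_wedge_cong[OF assms])

lemma slot_val_cong:
  assumes "\<And>e. fst e < i \<Longrightarrow> a e = a' e" "a (i, j) = a' (i, j)"
  shows "slot_val \<epsilon> a i j = slot_val \<epsilon> a' i j"
  by (simp add: slot_val_def slot_num_def slot_den_cong[OF assms(1)] prod_wedge_cong[OF assms(1)] assms(2))

lemma slot_num_normalized:
  assumes "\<And>e. fst e < i \<Longrightarrow> a e = a' e" "a (i, j) = Some False" "a' (i, j) = Some True"
  shows "slot_num \<epsilon> a i j + slot_num \<epsilon> a' i j = slot_den \<epsilon> a i j"
  by (simp add: slot_num_def slot_den_def prod_wedge_cong[OF assms(1)] assms(2,3) coin_def field_simps)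

section \<open>Normalization\<close>

definition complete_asg :: "'v set \<Rightarrow> ('v \<Rightarrow> bool option) \<Rightarrow> 'v set \<Rightarrow> 'v \<Rightarrow> bool option" where
  "complete_asg E a S = (\<lambda>i. if i \<in> E then Some (i \<in> S) else a i)"

lemma graph_asg_eq: "graph_asg M S = complete_asg (edgevars M) (\<lambda>_. None) S"
  by (auto simp: graph_asg_def complete_asg_def)

text \<open>The chain rule, with edges ranked by first endpoint only: slots with the same first
  endpoint never read each other's edge, so ties are harmless.\<close>

lemma sum_top_val:
  assumes "0 \<le> \<epsilon>" "\<epsilon> \<le> 1"
  shows "(\<Sum>S \<in> Pow (edgevars M). top_val M \<epsilon> (complete_asg (edgevars M) a S)) = 1"
  unfolding top_val_def
proof (rule sum_prod_conditionals_eq_1[where m = fst])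
  fix e and S T :: "(nat \<times> nat) set"
  assume "e \<in> S \<longleftrightarrow> e \<in> T" "\<And>e'. fst e' < fst e \<Longrightarrow> e' \<in> S \<longleftrightarrow> e' \<in> T"
  then show "(case e of (i, j) \<Rightarrow> slot_val \<epsilon> (complete_asg (edgevars M) a S) i j) =
      (case e of (i, j) \<Rightarrow> slot_val \<epsilon> (complete_asg (edgevars M) a T) i j)"
    by (cases e) (auto simp: complete_asg_def intro!: slot_val_cong)
next
  fix e S assume e: "e \<in> edgevars M" "e \<notin> S"
  obtain i j where ij: "e = (i, j)" by fastforce
  let ?a = "complete_asg (edgevars M) a S" and ?a' = "complete_asg (edgevars M) a (insert e S)"
  have cong: "?a e' = ?a' e'" if "fst e' < i" for e'
    using that by (auto simp: complete_asg_def ij)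
  have "slot_val \<epsilon> ?a i j + slot_val \<epsilon> ?a' i j =
      (slot_num \<epsilon> ?a i j + slot_num \<epsilon> ?a' i j) / slot_den \<epsilon> ?a i j"
    by (simp add: slot_val_def slot_den_cong[of i ?a ?a', OF cong] add_divide_distrib)
  also have "\<dots> = 1"
    using slot_den_pos[OF assms, of ?a i j] e
    by (subst slot_num_normalized[OF cong]) (auto simp: complete_asg_def ij)
  finally show "(case e of (i, j) \<Rightarrow> slot_val \<epsilon> ?a i j) + (case e of (i, j) \<Rightarrow> slot_val \<epsilon> ?a' i j) = 1"
    by (simp add: ij)
qed simp

text \<open>The marginalization identity of conditional soundness in closed form. Without a context
  the denominator is 1 and the identity is a total mass, for \<open>Top\<close> that of the whole
  distribution. For a slot both coins sum to 1 and leave the mixture of the two contexts, which does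
  not read the edge (i, j).\<close>

lemma sum_num_val:
  assumes "valid_id M c" "0 \<le> \<epsilon>" "\<epsilon> \<le> 1"
  shows "(\<Sum>S \<in> Pow (own_edges M c). num_val M \<epsilon> (complete_asg (own_edges M c) a S) c) = den_val \<epsilon> a c"
proof (cases c)
  case (Coin b e)
  then show ?thesis
    using weight_sum[of \<epsilon> c]
    by (simp add: den_val_eq_1 sum_Pow_insert) (simp add: num_val_def complete_asg_def coin_def)
next
  case (Wedge b k i j)
  then have "i \<noteq> j" using assms by simp
  then show ?thesis
    by (simp add: Wedge den_val_eq_1 sum_Pow_insert)
       (simp add: num_val_def complete_asg_def coin_def bias_def field_simps)
next
  case (Slot i j)
  let ?a = "complete_asg {(i, j)} a {}"
  have "slot_num \<epsilon> ?a i j + slot_num \<epsilon> (complete_asg {(i, j)} a {(i, j)}) i j = slot_den \<epsilon> ?a i j"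
    by (rule slot_num_normalized) (auto simp: complete_asg_def)
  also have "\<dots> = slot_den \<epsilon> a i j"
    by (rule slot_den_cong) (auto simp: complete_asg_def)
  finally show ?thesis
    by (simp add: Slot sum_Pow_insert num_val_Slot den_val_Slot)
next
  case Top
  then show ?thesis
    using sum_top_val[OF assms(2,3), of M a] by (simp add: den_val_eq_1) (simp add: num_val_def)
qed

section \<open>Support on triangle-free graphs at bias 0\<close>

lemma wedge_val_0_graph:
  assumes "k < i" "i < j" "j < M"
  shows "wedge_val 0 (graph_asg M S) k i j > 0 \<longleftrightarrow> \<not> ((k, i) \<in> S \<and> (k, j) \<in> S)"
  using assms by (auto simp: wedge_val_def graph_asg_def edgevars_def coin_def)

lemma slot_val_0_graph:
  assumes "i < j" "j < M"
  shows "slot_val 0 (graph_asg M S) i j > 0 \<longleftrightarrow>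
    \<not> ((i, j) \<in> S \<and> (\<exists>k<i. (k, i) \<in> S \<and> (k, j) \<in> S))"
    and "slot_val 0 (graph_asg M S) i j \<ge> 0"
proof -
  let ?a = "graph_asg M S"
  let ?U = "\<Prod>k<i. wedge_val (1/2) ?a k i j" and ?T = "\<Prod>k<i. wedge_val 0 ?a k i j"
  have U: "?U > 0"
    by (simp add: prod_pos wedge_val_half_pos)
  have T: "?T \<ge> 0"
    by (simp add: prod_nonneg wedge_val_nonneg)
  have "?T \<noteq> 0 \<longleftrightarrow> (\<forall>k<i. wedge_val 0 ?a k i j > 0)"
    using wedge_val_nonneg[of 0 ?a _ i j] by (auto simp: less_le)
  then have T0: "?T > 0 \<longleftrightarrow> \<not> (\<exists>k<i. (k, i) \<in> S \<and> (k, j) \<in> S)"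
    using wedge_val_0_graph[OF _ assms] T by (auto simp: less_le)
  \<comment> \<open>If (i, j) is present, the coin of bias 0 removes the component with
    \<open>?U\<close> and only half of \<open>?T\<close> is left. If it is absent, that coin equals
    1 and \<open>?U\<close> keeps the value positive whatever the context.\<close>
  have num: "slot_num 0 ?a i j = (if (i, j) \<in> S then ?T / 4 else (?U + ?T / 2) / 2)"
    using assms by (simp add: slot_num_def graph_asg_def edgevars_def coin_def)
  have "slot_den 0 ?a i j > 0"
    by (simp add: slot_den_pos)
  moreover have "slot_num 0 ?a i j > 0 \<longleftrightarrow> \<not> ((i, j) \<in> S \<and> (\<exists>k<i. (k, i) \<in> S \<and> (k, j) \<in> S))"
    using U T T0 unfolding num by auto
  moreover have "slot_num 0 ?a i j \<ge> 0"
    using U T unfolding num by auto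
  ultimately show "slot_val 0 ?a i j > 0 \<longleftrightarrow> \<not> ((i, j) \<in> S \<and> (\<exists>k<i. (k, i) \<in> S \<and> (k, j) \<in> S))"
    "slot_val 0 ?a i j \<ge> 0"
    by (simp_all add: slot_val_def zero_less_divide_iff)
qed

text \<open>A triangle k < i < j is charged to its edge (i, j), the one avoiding the least vertex;
  the inclusion in \<open>edgevars M\<close> makes that edge one of the slots.\<close>

lemma has_triangle_iff:
  assumes "S \<subseteq> edgevars M"
  shows "has_triangle S \<longleftrightarrow>
    (\<exists>(i, j) \<in> edgevars M. (i, j) \<in> S \<and> (\<exists>k<i. (k, i) \<in> S \<and> (k, j) \<in> S))"
proof
  assume "has_triangle S"
  then obtain k i j where "k < i" "i < j" "(k, i) \<in> S" "(i, j) \<in> S" "(k, j) \<in> S"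
    unfolding has_triangle_def by blast
  then show "\<exists>(i, j) \<in> edgevars M. (i, j) \<in> S \<and> (\<exists>k<i. (k, i) \<in> S \<and> (k, j) \<in> S)"
    using assms by blast
next
  assume "\<exists>(i, j) \<in> edgevars M. (i, j) \<in> S \<and> (\<exists>k<i. (k, i) \<in> S \<and> (k, j) \<in> S)"
  then show "has_triangle S"
    unfolding has_triangle_def edgevars_def by blast
qed

text \<open>All factors are nonnegative, so the product is positive exactly when no slot vanishes,
  that is, when no edge closes a triangle. The total mass is the chain rule started from the
  assignment that leaves everything open.\<close>

lemma tf_dist_top_val: "tf_dist M (\<lambda>S. top_val M 0 (graph_asg M S))"
  unfolding tf_dist_def
proof (intro conjI allI impI)
  fix S assume S: "S \<subseteq> edgevars M"
  have nonneg: "(case e of (i, j) \<Rightarrow> slot_val 0 (graph_asg M S) i j) \<ge> 0" if "e \<in> edgevars M" for e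
    using that slot_val_0_graph(2) by (auto simp: edgevars_def)
  then show top: "top_val M 0 (graph_asg M S) \<ge> 0"
    unfolding top_val_def by (rule prod_nonneg)
  have "top_val M 0 (graph_asg M S) \<noteq> 0 \<longleftrightarrow>
      (\<forall>e \<in> edgevars M. (case e of (i, j) \<Rightarrow> slot_val 0 (graph_asg M S) i j) > 0)"
    unfolding top_val_def using nonneg by (simp add: less_le)
  also have "\<dots> \<longleftrightarrow> (\<forall>(i, j) \<in> edgevars M. \<not> ((i, j) \<in> S \<and> (\<exists>k<i. (k, i) \<in> S \<and> (k, j) \<in> S)))"
    by (rule ball_cong) (auto simp: edgevars_def slot_val_0_graph(1))
  also have "\<dots> \<longleftrightarrow> \<not> has_triangle S"
    unfolding has_triangle_iff[OF S] by blast
  finally show "top_val M 0 (graph_asg M S) > 0 \<longleftrightarrow> \<not> has_triangle S"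
    using top by (simp add: less_le)
next
  show "(\<Sum>S \<in> Pow (edgevars M). top_val M 0 (graph_asg M S)) = 1"
    unfolding graph_asg_eq by (rule sum_top_val) simp_all
qed

section \<open>Continuity in the bias\<close>

lemma tendsto_coin:
  fixes p :: "nat \<Rightarrow> real"
  shows "p \<longlonglongrightarrow> q \<Longrightarrow> (\<lambda>k. coin (p k) x) \<longlonglongrightarrow> coin q x"
  by (auto simp: coin_def split: option.split intro!: tendsto_intros)

text \<open>The output is built from coins by sums, products and one division per slot. The limiting
  denominators are nonzero even at \<open>q = 0\<close>, so the limit passes through.\<close>

lemma tendsto_top_val:
  fixes p :: "nat \<Rightarrow> real"
  assumes "p \<longlonglongrightarrow> q" "0 \<le> q" "q \<le> 1"
  shows "(\<lambda>k. top_val M (p k) a) \<longlonglongrightarrow> top_val M q a"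
proof -
  have wedge: "(\<lambda>n. wedge_val (p n) a k i j) \<longlonglongrightarrow> wedge_val q a k i j" for k i j
    unfolding wedge_val_def by (intro tendsto_intros tendsto_coin assms(1)) simp
  have "(\<lambda>n. slot_val (p n) a i j) \<longlonglongrightarrow> slot_val q a i j" for i j
    unfolding slot_val_def
  proof (rule tendsto_divide)
    show "(\<lambda>n. slot_num (p n) a i j) \<longlonglongrightarrow> slot_num q a i j"
      unfolding slot_num_def by (intro tendsto_intros tendsto_coin wedge assms(1)) simp
    show "(\<lambda>n. slot_den (p n) a i j) \<longlonglongrightarrow> slot_den q a i j"
      unfolding slot_den_def by (intro tendsto_intros wedge) simp
    show "slot_den q a i j \<noteq> 0"
      using slot_den_pos[OF assms(2,3), of a i j] by simp
  qed
  then show ?thesis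
    unfolding top_val_def split_beta by (intro tendsto_prod)
qed

section \<open>Structural conditions on the network\<close>

text \<open>\<open>\<epsilon> < 1\<close> keeps both weights of a biased coin positive, and
  \<open>M \<ge> 2\<close> guarantees the edge (0, 1). Since numberings may have gaps,
  \<open>bound\<close> may exceed the number of names.\<close>

locale triangle_net =
  fixes M :: nat and \<epsilon> :: real and idx :: "name \<Rightarrow> nat" and bound :: nat
  assumes M_ge_2: "M \<ge> 2"
    and eps_nonneg: "0 \<le> \<epsilon>" and eps_less_1: "\<epsilon> < 1"
    and inj_idx: "inj_on idx (names M)"
    and idx_bound: "n \<in> names M \<Longrightarrow> idx n < bound"
    and idx_mono: "n \<in> names M \<Longrightarrow> n' \<in> names M \<Longrightarrow> name_rank n < name_rank n' \<Longrightarrow> idx n < idx n'"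
begin

text \<open>Indices that carry no name become leaves, which do not count towards the size.\<close>

definition net :: "(nat \<times> nat) spqn" where
  "net = \<lparr>nnodes = bound,
     lab = (\<lambda>v. if v \<in> idx ` names M then label M \<epsilon> idx (the_inv_into (names M) idx v)
                 else Leaf (0, 1) True),
     root = idx (Quo Top)\<rparr>"

lemma lab_net [simp]: "n \<in> names M \<Longrightarrow> lab net (idx n) = label M \<epsilon> idx n"
  by (simp add: net_def the_inv_into_f_f[OF inj_idx])

lemma lab_cases:
  obtains "lab net v = Leaf (0, 1) True" | n where "n \<in> names M" "v = idx n"
proof (cases "v \<in> idx ` names M")
  case False
  then show ?thesis using that(1) by (simp add: net_def)
qed (use that(2) in blast)

lemma a_names_rank: "n \<in> set (a_names c s) \<Longrightarrow> name_rank n < 4 * id_rank c"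
  by (cases c) auto

lemma b_names_rank: "n \<in> set (b_names M \<epsilon> c s) \<Longrightarrow> name_rank n < 4 * id_rank c"
  by (cases c) (auto split: if_splits)

lemma a_names_valid: "valid_id M c \<Longrightarrow> n \<in> set (a_names c s) \<Longrightarrow> n \<in> names M"
  by (cases c) (auto simp: names_def)

lemma b_names_valid: "valid_id M c \<Longrightarrow> n \<in> set (b_names M \<epsilon> c s) \<Longrightarrow> n \<in> names M"
  by (cases c) (auto simp: names_def edgevars_def split: if_splits)

lemma idx_a_names:
  "valid_id M c \<Longrightarrow> n \<in> set (a_names c s) \<Longrightarrow> idx n < idx (PA c s)"
  by (rule idx_mono, erule (1) a_names_valid) (simp_all add: names_def a_names_rank)

lemma idx_b_names:
  "valid_id M c \<Longrightarrow> n \<in> set (b_names M \<epsilon> c s) \<Longrightarrow> idx n < idx (PB c s)"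
  by (rule idx_mono, erule (1) b_names_valid) (simp_all add: names_def b_names_rank)

lemma idx_inner:
  assumes "valid_id M c"
  shows "idx (PA c s) < idx (Mix c s)" "idx (PB c s) < idx (Mix c s)"
    "idx (Mix c s) < idx (Num c)" "idx (PA c s) < idx (Den c)"
    "idx (Num c) < idx (Quo c)" "idx (Den c) < idx (Quo c)"
  using assms by (auto intro!: idx_mono simp: names_def)

text \<open>One recursion principle for values, scopes and effective scopes, with one obligation per
  kind of name. Children have smaller indices by the ranking, so the closed form is available for
  them.\<close>

lemma at_node_net:
  assumes leaf: "\<And>e b r. f r (Leaf e b) = t (Lf e b)"
    and pa: "\<And>c s r. valid_id M c \<Longrightarrow> (\<And>n. n \<in> set (a_names c s) \<Longrightarrow> r (idx n) = t n) \<Longrightarrow>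
               f r (ProdN (map idx (a_names c s))) = t (PA c s)"
    and pb: "\<And>c s r. valid_id M c \<Longrightarrow> (\<And>n. n \<in> set (b_names M \<epsilon> c s) \<Longrightarrow> r (idx n) = t n) \<Longrightarrow>
               f r (ProdN (map idx (b_names M \<epsilon> c s))) = t (PB c s)"
    and mix: "\<And>c s r. valid_id M c \<Longrightarrow> r (idx (PA c s)) = t (PA c s) \<Longrightarrow>
               r (idx (PB c s)) = t (PB c s) \<Longrightarrow> f r (label M \<epsilon> idx (Mix c s)) = t (Mix c s)"
    and num: "\<And>c r. valid_id M c \<Longrightarrow> (\<And>s. r (idx (Mix c s)) = t (Mix c s)) \<Longrightarrow>
               f r (label M \<epsilon> idx (Num c)) = t (Num c)"
    and den: "\<And>c r. valid_id M c \<Longrightarrow> (\<And>s. r (idx (PA c s)) = t (PA c s)) \<Longrightarrow>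
               f r (label M \<epsilon> idx (Den c)) = t (Den c)"
    and quo: "\<And>c r. valid_id M c \<Longrightarrow> r (idx (Num c)) = t (Num c) \<Longrightarrow>
               r (idx (Den c)) = t (Den c) \<Longrightarrow> f r (label M \<epsilon> idx (Quo c)) = t (Quo c)"
    and n: "n \<in> names M"
  shows "at_node f (lab net) (idx n) = t n"
proof (rule at_node_eqI[where K = "names M", OF _ n])
  fix n r
  assume n: "n \<in> names M" and r: "\<And>n'. n' \<in> names M \<Longrightarrow> idx n' < idx n \<Longrightarrow> r (idx n') = t n'"
  show "f r (lab net (idx n)) = t n"
  proof (cases n)
    case (Lf e b)
    then show ?thesis using n leaf by simp
  next
    case (PA c s)
    then have c: "valid_id M c" using n by (simp add: names_def)
    show ?thesis unfolding lab_net[OF n] unfolding PA label.simps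
      by (rule pa[OF c], rule r) (auto simp: PA intro: a_names_valid idx_a_names c)
  next
    case (PB c s)
    then have c: "valid_id M c" using n by (simp add: names_def)
    show ?thesis unfolding lab_net[OF n] unfolding PB label.simps
      by (rule pb[OF c], rule r) (auto simp: PB intro: b_names_valid idx_b_names c)
  next
    case (Mix c s)
    then have c: "valid_id M c" using n by (simp add: names_def)
    show ?thesis unfolding lab_net[OF n] unfolding Mix
      by (rule mix[OF c]; rule r) (auto simp: Mix c names_def idx_inner)
  next
    case (Num c)
    then have c: "valid_id M c" using n by (simp add: names_def)
    show ?thesis unfolding lab_net[OF n] unfolding Num
      by (rule num[OF c]; rule r) (auto simp: Num c names_def idx_inner)
  next
    case (Den c)
    then have c: "valid_id M c" using n by (simp add: names_def)
    show ?thesis unfolding lab_net[OF n] unfolding Den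
      by (rule den[OF c]; rule r) (auto simp: Den c names_def idx_inner)
  next
    case (Quo c)
    then have c: "valid_id M c" using n by (simp add: names_def)
    show ?thesis unfolding lab_net[OF n] unfolding Quo
      by (rule quo[OF c]; rule r) (auto simp: Quo c names_def idx_inner)
  qed
qed

lemma Psi_net: "n \<in> names M \<Longrightarrow> Psi net a (idx n) = val M \<epsilon> a n"
  unfolding Psi_def
proof (rule at_node_net)
  fix c s and r :: "nat \<Rightarrow> real"
  assume c: "valid_id M c"
  {
    assume r: "\<And>n. n \<in> set (a_names c s) \<Longrightarrow> r (idx n) = val M \<epsilon> a n"
    have "evalnode a r (ProdN (map idx (a_names c s))) = prod_list (map (val M \<epsilon> a) (a_names c s))"
      using r by (simp add: comp_def cong: map_cong)
    also have "\<dots> = pa_val \<epsilon> a c s"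
      by (cases c)
         (simp_all del: val.simps add: comp_def prod.distinct_set_conv_list[symmetric] lessThan_atLeast0)
    finally show "evalnode a r (ProdN (map idx (a_names c s))) = val M \<epsilon> a (PA c s)" by simp
  next
    assume r: "\<And>n. n \<in> set (b_names M \<epsilon> c s) \<Longrightarrow> r (idx n) = val M \<epsilon> a n"
    have "evalnode a r (ProdN (map idx (b_names M \<epsilon> c s))) =
        prod_list (map (val M \<epsilon> a) (b_names M \<epsilon> c s))"
      using r by (simp add: comp_def cong: map_cong)
    also have "\<dots> = pb_val M \<epsilon> a c s"
    proof (cases c)
      case Top
      show ?thesis unfolding Top b_names.simps pb_val.simps top_val_def
        by (simp del: val.simps add: comp_def split_beta val_Slot
            prod.distinct_set_conv_list[OF distinct_edge_list, symmetric])
    qed (simp_all del: val.simps(2-) coin_name.simps)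
    finally show "evalnode a r (ProdN (map idx (b_names M \<epsilon> c s))) = val M \<epsilon> a (PB c s)" by simp
  }
qed (auto simp: coin_def num_val_def den_val_def split: option.split)

lemma eff_net [simp]: "n \<in> names M \<Longrightarrow> eff net (idx n) = name_eff M n"
  unfolding eff_def
proof (rule at_node_net)
  fix c s and r :: "nat \<Rightarrow> (nat \<times> nat) set"
  assume c: "valid_id M c"
  show "effnode r (ProdN (map idx (a_names c s))) = name_eff M (PA c s)"
    if "\<And>n. n \<in> set (a_names c s) \<Longrightarrow> r (idx n) = name_eff M n"
    using that by (cases c) (auto simp: lessThan_atLeast0)
  show "effnode r (ProdN (map idx (b_names M \<epsilon> c s))) = name_eff M (PB c s)"
    if "\<And>n. n \<in> set (b_names M \<epsilon> c s) \<Longrightarrow> r (idx n) = name_eff M n"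
    using that by (cases c) (auto split: if_splits)
next
  fix c and r :: "nat \<Rightarrow> (nat \<times> nat) set"
  assume "valid_id M c" "r (idx (Num c)) = name_eff M (Num c)" "r (idx (Den c)) = name_eff M (Den c)"
  \<comment> \<open>Subtracting the context leaves exactly the own edges, since (i, j) has first
    endpoint i while context edges have smaller ones; the other kinds have an empty context.\<close>
  then show "effnode r (label M \<epsilon> idx (Quo c)) = name_eff M (Quo c)"
    by (cases c) auto
qed auto

lemma sc_net: "n \<in> names M \<Longrightarrow> sc net (idx n) = name_sc M n"
  unfolding sc_def
proof (rule at_node_net)
  fix c s and r :: "nat \<Rightarrow> (nat \<times> nat) set"
  assume c: "valid_id M c"
  show "scnode r (ProdN (map idx (a_names c s))) = name_sc M (PA c s)"
    if "\<And>n. n \<in> set (a_names c s) \<Longrightarrow> r (idx n) = name_sc M n"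
    using that by (cases c) (auto simp: lessThan_atLeast0)
  \<comment> \<open>For \<open>Top\<close> the contexts add nothing new: (k, i) and (k, j) with k <
    i < j < M are edges already.\<close>
  show "scnode r (ProdN (map idx (b_names M \<epsilon> c s))) = name_sc M (PB c s)"
    if "\<And>n. n \<in> set (b_names M \<epsilon> c s) \<Longrightarrow> r (idx n) = name_sc M n"
    using that c by (cases c) (auto simp: edgevars_def split: if_splits, blast)
next
  fix c and r :: "nat \<Rightarrow> (nat \<times> nat) set"
  assume "valid_id M c" "r (idx (Num c)) = name_sc M (Num c)" "r (idx (Den c)) = name_sc M (Den c)"
  then show "scnode r (label M \<epsilon> idx (Quo c)) = name_sc M (Quo c)"
    by (cases c) auto
qed auto

section \<open>Well-formedness and size\<close>

lemma wf_net: "wf_spqn net"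
  unfolding wf_spqn_def
proof (intro conjI allI impI)
  show "root net < nnodes net"
    by (simp add: net_def idx_bound names_def)
next
  fix v assume "v < nnodes net"
  show "\<forall>c \<in> set (children (lab net v)). c < v"
  proof (cases rule: lab_cases[of v])
    case (2 n)
    then show ?thesis
      using idx_a_names idx_b_names idx_inner by (cases n) (auto simp: names_def)
  qed simp
next
  fix v ws assume "v < nnodes net" and ws: "lab net v = SumN ws"
  have "(\<forall>(w, c) \<in> set ws. w > 0) \<and> sum_list (map fst ws) = 1"
  proof (cases rule: lab_cases[of v])
    case (2 n)
    then show ?thesis
      using ws weight_pos[OF eps_nonneg eps_less_1] weight_sum
      by (cases n) auto
  qed (use ws in simp)
  then show "\<forall>(w, c) \<in> set ws. w > 0" "sum_list (map fst ws) = 1" by auto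
qed

lemma over_vars_net: "over_vars net (edgevars M)"
  unfolding over_vars_def
proof (intro allI impI)
  fix v x b assume x: "lab net v = Leaf x b"
  show "x \<in> edgevars M"
  proof (cases rule: lab_cases[of v])
    \<comment> \<open>The filler leaf reads (0, 1), an edge variable because
      \<open>M \<ge> 2\<close>.\<close>
    case 1
    then show ?thesis using x M_ge_2 by (simp add: edgevars_def)
  next
    case (2 n)
    then show ?thesis using x by (cases n) (auto simp: names_def)
  qed
qed

lemma size_net: "spqn_size net \<le> 63 * M ^ 4"
proof -
  let ?I = "\<Union>c \<in> {c. valid_id M c}. inner_names c"
  have "{v. v < nnodes net \<and> \<not> is_leaf (lab net v)} \<subseteq> idx ` ?I"
  proof
    fix v assume v: "v \<in> {v. v < nnodes net \<and> \<not> is_leaf (lab net v)}"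
    show "v \<in> idx ` ?I"
    proof (cases rule: lab_cases[of v])
      case (2 n)
      from \<open>n \<in> names M\<close> show ?thesis
      proof (cases rule: names_cases)
        case (leaf e b)
        have "lab net v = Leaf e b"
          unfolding \<open>v = idx n\<close> lab_net[OF \<open>n \<in> names M\<close>] unfolding leaf by simp
        then show ?thesis using v by simp
      next
        case (inner c)
        then show ?thesis unfolding \<open>v = idx n\<close> by blast
      qed
    qed (use v in simp)
  qed
  moreover have fin: "finite ?I"
    using card_valid_ids(1) by simp
  ultimately have "spqn_size net \<le> card (idx ` ?I)"
    unfolding spqn_size_def by (intro card_mono) auto
  also have "\<dots> \<le> card ?I"
    using fin by (rule card_image_le)
  \<comment> \<open>Nine internal nodes for each of at most 6 * M^3 + 1 CMO nodes; the remaining 9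
    is absorbed by M^3.\<close>
  also have "\<dots> \<le> 54 * M ^ 3 + 9"
    using card_inner_names[of M] by simp
  also have "\<dots> \<le> 63 * M ^ 3"
    using M_ge_2 by simp
  also have "\<dots> \<le> 63 * M ^ 4"
    using M_ge_2 by (simp add: power_increasing)
  finally show ?thesis .
qed

section \<open>Conditional completeness, decomposability and soundness\<close>

lemma context_own_disjoint: "valid_id M c \<Longrightarrow> context_edges c \<inter> own_edges M c = {}"
  by (cases c) auto

lemma cond_net: "n \<in> names M \<Longrightarrow> cond net (idx n) = name_sc M n - name_eff M n"
  by (simp add: cond_def sc_net)

lemma cond_net_empty: "n \<in> names M \<Longrightarrow> \<nexists>i j. n = Quo (Slot i j) \<Longrightarrow> cond net (idx n) = {}"
  by (cases n; (rename_tac c, case_tac c)?) (auto simp: cond_net)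

lemma cond_complete_net: "cc_sum net v"
  unfolding cc_sum_def
proof (intro allI impI ballI)
  fix ws c c' assume ws: "lab net v = SumN ws" "c \<in> set (map snd ws)" "c' \<in> set (map snd ws)"
  show "eff net c = eff net c'"
  proof (cases rule: lab_cases[of v])
    case (2 n)
    then show ?thesis using ws by (cases n) (auto simp: names_def)
  qed (use ws in simp)
qed

text \<open>A dependency from slot (i, j) to slot (i', j') puts (i, j) into the context of (i', j'),
  which forces i < i'. The first endpoint thus increases along every dependency.\<close>

lemma acyclic_slots:
  assumes "set cs \<subseteq> (\<lambda>(i, j). idx (Quo (Slot i j))) ` edgevars M"
  shows "acyclic {(c', c''). c' \<in> set cs \<and> c'' \<in> set cs \<and> eff net c' \<inter> cond net c'' \<noteq> {}}"
proof (rule acyclic_subset[OF wf_acyclic[OF wf_measure]], rule subsetI)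
  fix p assume "p \<in> {(c', c''). c' \<in> set cs \<and> c'' \<in> set cs \<and> eff net c' \<inter> cond net c'' \<noteq> {}}"
  then obtain c' c'' where p: "p = (c', c'')" "c' \<in> set cs" "c'' \<in> set cs"
    "eff net c' \<inter> cond net c'' \<noteq> {}" by blast
  obtain i j i' j' where c: "c' = idx (Quo (Slot i j))" "(i, j) \<in> edgevars M"
      "c'' = idx (Quo (Slot i' j'))" "(i', j') \<in> edgevars M"
    using subsetD[OF assms p(2)] subsetD[OF assms p(3)] by auto
  then have n: "Quo (Slot i j) \<in> names M" "Quo (Slot i' j') \<in> names M"
    by (auto simp: names_def edgevars_def)
  have "i < i'"
    using p(4) unfolding c by (auto simp: cond_net n)
  \<comment> \<open>The effective scope of a slot is a singleton, so its edge can be read off from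
    the node.\<close>
  then show "p \<in> measure (\<lambda>v. fst (the_elem (eff net v)))"
    by (simp add: p(1) c n)
qed

lemma cond_decomposable_net: "cd_prod net v"
proof (cases rule: lab_cases[of v])
  case 1
  then show ?thesis by (simp add: cd_prod_def)
next
  case (2 n)
  note v = \<open>v = idx n\<close> and lab = lab_net[OF \<open>n \<in> names M\<close>]
  show ?thesis
  proof (cases n)
    case (Mix c s)
    then have c: "valid_id M c" using 2 by (simp add: names_def)
    then have n: "PA c s \<in> names M" "PB c s \<in> names M" by (auto simp: names_def)
    show ?thesis
    proof (rule cd_prodI)
      show "lab net v = ProdN [idx (PA c s), idx (PB c s)]"
        unfolding v lab unfolding Mix by simp
      show "eff net ([idx (PA c s), idx (PB c s)] ! i) \<inter> eff net ([idx (PA c s), idx (PB c s)] ! j) = {}"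
        if "i < j" "j < length [idx (PA c s), idx (PB c s)]" for i j
        using that n context_own_disjoint[OF c] by (auto simp: less_Suc_eq)
    qed (rule acyclic_no_cond, use n in \<open>auto simp: cond_net_empty\<close>)
  next
    case (PA c s)
    then have c: "valid_id M c" using 2 by (simp add: names_def)
    show ?thesis
    proof (rule cd_prodI)
      show "lab net v = ProdN (map idx (a_names c s))"
        unfolding v lab unfolding PA by simp
      have "\<nexists>i j. n = Quo (Slot i j)" if "n \<in> set (a_names c s)" for n
        using that by (cases c) auto
      then show "acyclic {(c', c''). c' \<in> set (map idx (a_names c s)) \<and>
          c'' \<in> set (map idx (a_names c s)) \<and> eff net c' \<inter> cond net c'' \<noteq> {}}"
        using a_names_valid[OF c] by (intro acyclic_no_cond) (auto intro!: cond_net_empty)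
      \<comment> \<open>Only a slot has several context children; wedges at distinct k and l own
        edges with distinct first endpoints.\<close>
      show "eff net (map idx (a_names c s) ! k) \<inter> eff net (map idx (a_names c s) ! l) = {}"
        if "k < l" "l < length (map idx (a_names c s))" for k l
      proof (cases c)
        case (Slot i j)
        then have "Quo (Wedge s k i j) \<in> names M" "Quo (Wedge s l i j) \<in> names M"
          using that c by (auto simp: names_def)
        then show ?thesis using that c by (auto simp: Slot)
      qed (use that in auto)
    qed
  next
    case (PB c s)
    then have c: "valid_id M c" using 2 by (simp add: names_def)
    let ?cs = "map idx (b_names M \<epsilon> c s)"
    note valid = b_names_valid[OF c, of _ s]
    show ?thesis
    proof (rule cd_prodI)
      show "lab net v = ProdN ?cs"
        unfolding v lab unfolding PB by simp
      \<comment> \<open>Only \<open>Top\<close> multiplies nodes with conditional scope; every other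
        product has no dependencies at all.\<close>
      show "acyclic {(c', c''). c' \<in> set ?cs \<and> c'' \<in> set ?cs \<and> eff net c' \<inter> cond net c'' \<noteq> {}}"
      proof (cases "c = Top")
        case True
        then show ?thesis by (intro acyclic_slots) auto
      next
        case False
        then have "\<nexists>i j. n = Quo (Slot i j)" if "n \<in> set (b_names M \<epsilon> c s)" for n
          using that by (cases c) (auto split: if_splits)
        then show ?thesis
          using valid by (intro acyclic_no_cond) (auto intro!: cond_net_empty)
      qed
      show "eff net (?cs ! k) \<inter> eff net (?cs ! l) = {}" if kl: "k < l" "l < length ?cs" for k l
      proof -
        have eff: "eff net (?cs ! m) = name_eff M (b_names M \<epsilon> c s ! m)" if "m < length ?cs" for m
          using that valid[of "b_names M \<epsilon> c s ! m"] by simp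
        have "name_eff M (b_names M \<epsilon> c s ! k) \<inter> name_eff M (b_names M \<epsilon> c s ! l) = {}"
        proof (cases c)
          case Top
          have "edge_list M ! k \<noteq> edge_list M ! l"
            using kl by (simp add: Top nth_eq_iff_index_eq[OF distinct_edge_list])
          then show ?thesis using kl by (simp add: Top split_beta prod_eq_iff)
        qed (use kl c in \<open>auto simp: less_Suc_eq\<close>)
        then show ?thesis using eff kl by simp
      qed
    qed
  qed (unfold cd_prod_def v lab, simp_all)
qed

text \<open>Numerators and denominators have empty conditional scope, so the scope inclusions are
  immediate; positivity and marginalization are the closed-form facts about \<open>den_val\<close>
  and \<open>num_val\<close>, as the quotient's effective scope is
  \<open>own_edges M c\<close>.\<close>

lemma cond_sound_net: "cond_sound net"
  unfolding cond_sound_def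
proof (intro allI impI)
  fix v nu de assume "v < nnodes net" and lab: "lab net v = QuotN nu de"
  obtain c where c: "valid_id M c" "v = idx (Quo c)" "nu = idx (Num c)" "de = idx (Den c)"
  proof (cases rule: lab_cases[of v])
    case (2 n)
    then show ?thesis using lab that by (cases n) (auto simp: names_def)
  qed (use lab in simp)
  then have n: "Quo c \<in> names M" "Num c \<in> names M" "Den c \<in> names M"
    by (auto simp: names_def)
  have sum: "(\<Sum>S \<in> Pow (own_edges M c).
      num_val M \<epsilon> (\<lambda>i. if i \<in> own_edges M c then Some (i \<in> S) else a i) c) = den_val \<epsilon> a c" for a
    using sum_num_val[OF c(1) eps_nonneg less_imp_le[OF eps_less_1], of a]
    by (simp add: complete_asg_def)
  show "(\<forall>a. Psi net a de > 0) \<and> cond net de \<subseteq> cond net nu \<and> eff net de \<subseteq> eff net nu \<and>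
     (\<forall>a. Psi net a de = (\<Sum>S \<in> Pow (eff net v).
        Psi net (\<lambda>i. if i \<in> eff net v then Some (i \<in> S) else a i) nu))"
    using eps_nonneg eps_less_1
    by (simp add: c(2-4) n cond_net_empty Psi_net sum den_val_pos)
qed

section \<open>Composition from valid CMO nodes\<close>

lemma cmo_node_net:
  assumes c: "valid_id M c"
  shows "cmo_node net (idx (Quo c)) (length (a_names c False)) (length (b_names M \<epsilon> c False)) 2
    (\<lambda>i. weight \<epsilon> c (i = 1)) (\<lambda>i j. idx (a_names c (i = 1) ! j))
    (\<lambda>i j. idx (b_names M \<epsilon> c (i = 1) ! j))"
proof -
  have n: "Quo c \<in> names M" "Num c \<in> names M" "Den c \<in> names M"
      "Mix c s \<in> names M" "PA c s \<in> names M" "PB c s \<in> names M" for s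
    using c by (auto simp: names_def)
  have two: "[0..<2] = [0, 1::nat]" "{..<2} = {0, 1::nat}"
    by (auto simp: numeral_2_eq_2)
  \<comment> \<open>Components 0 and 1 are the Booleans False and True. Both have equally many
    children, so lengths taken at False serve as \<alpha> and \<beta>.\<close>
  have len: "length (a_names c s) = length (a_names c False)"
    "length (b_names M \<epsilon> c s) = length (b_names M \<epsilon> c False)" for s
    by (cases c; simp)+
  have map: "map (\<lambda>j. idx (xs ! j)) [0..<length xs] = map idx xs" for xs
    by (rule nth_equalityI) auto
  have labs: "lab net (idx (PA c s)) = ProdN (map (\<lambda>j. idx (a_names c s ! j)) [0..<length (a_names c False)])"
    "lab net (idx (PB c s)) = ProdN (map (\<lambda>j. idx (b_names M \<epsilon> c s ! j)) [0..<length (b_names M \<epsilon> c False)])"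
    for s
    using map[of "a_names c s"] map[of "b_names M \<epsilon> c s"] by (simp_all add: n len(1)[of s] len(2)[of s])
  \<comment> \<open>At least one edge exists, which gives \<beta> > 0 for
    \<open>Top\<close>.\<close>
  have "(0, 1) \<in> set (edge_list M)"
    using M_ge_2 by (simp add: edgevars_def)
  then have "edge_list M \<noteq> []"
    by (auto simp del: set_edge_list)
  then have "length (b_names M \<epsilon> c False) > 0"
    by (cases c) auto
  then show ?thesis
    by (intro cmo_nodeI[where nu = "idx (Num c)" and de = "idx (Den c)" and
          p = "\<lambda>i. idx (Mix c (i = 1))" and PA = "\<lambda>i. idx (PA c (i = 1))" and
          PB = "\<lambda>i. idx (PB c (i = 1))" and X = "own_edges M c"])
      (use weight_pos[OF eps_nonneg eps_less_1] weight_sum[of \<epsilon> c] in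
       \<open>auto simp: two n labs cond_complete_net cond_decomposable_net cond_net_empty
          simp del: label.simps(2,3)\<close>)
qed

text \<open>For \<open>\<epsilon> > 0\<close> no bare leaf occurs outside the coins. Validity then
  climbs the levels: coins are base nodes over the two leaves of an edge, wedges use coins, slots
  use wedges and coins, and \<open>Top\<close> uses slots.\<close>

lemma valid_cmo_net:
  assumes "\<epsilon> > 0" "valid_id M c"
  shows "valid_cmo net (idx (Quo c))"
proof -
  have coin: "valid_cmo net (idx (Quo (Coin b e)))" if "e \<in> edgevars M" for b e
  proof -
    have "valid_id M (Coin b e)" "Lf e False \<in> names M" "Lf e True \<in> names M"
      using that by (auto simp: names_def)
    then show ?thesis
      using valid_cmo.base[of net _ _ _ _ e] cmo_node_net[of "Coin b e"] by fastforce
  qed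
  have coin_name: "valid_cmo net (idx (coin_name \<epsilon> b e))" if "e \<in> edgevars M" for b e
    using coin[OF that] assms(1) by simp
  have step: "valid_cmo net (idx (Quo c))"
    if "valid_id M c" "\<And>n s. n \<in> set (a_names c s) \<union> set (b_names M \<epsilon> c s) \<Longrightarrow> valid_cmo net (idx n)" for c
  proof (rule valid_cmo.step[OF cmo_node_net[OF that(1)]])
    have len: "length (a_names c s) = length (a_names c False)"
      "length (b_names M \<epsilon> c s) = length (b_names M \<epsilon> c False)" for s
      by (cases c; simp)+
    show "\<forall>i<2. \<forall>j<length (a_names c False). valid_cmo net (idx (a_names c (i = 1) ! j))"
      by (metis UnI1 len(1) nth_mem that(2))
    show "\<forall>i<2. \<forall>j<length (b_names M \<epsilon> c False). valid_cmo net (idx (b_names M \<epsilon> c (i = 1) ! j))"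
      by (metis UnI2 len(2) nth_mem that(2))
  qed
  have wedge: "valid_cmo net (idx (Quo (Wedge b k i j)))" if "valid_id M (Wedge b k i j)" for b k i j
    using that by (intro step) (auto simp: edgevars_def simp del: coin_name.simps intro!: coin_name)
  have slot: "valid_cmo net (idx (Quo (Slot i j)))" if "valid_id M (Slot i j)" for i j
    using that by (intro step) (auto simp: edgevars_def simp del: coin_name.simps intro!: coin_name wedge)
  have "valid_cmo net (idx (Quo Top))"
    by (intro step) (auto simp: edgevars_def intro!: slot)
  with coin wedge slot assms(2) show ?thesis
    by (cases c) (auto simp: edgevars_def)
qed

lemma Psi_root_net: "Psi net a (root net) = top_val M \<epsilon> a"
proof -
  have "Quo Top \<in> names M" by (simp add: names_def)
  from Psi_net[OF this] show ?thesis by (simp only: val_Top) (simp add: net_def)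
qed

lemma cmo_composed_net: "\<epsilon> > 0 \<Longrightarrow> cmo_composed net"
  using valid_cmo_net[of Top] by (simp add: cmo_composed_def net_def)

end

section \<open>The exact network and the approximating sequence\<close>

theorem theorem3:
  shows "(\<exists>C::nat. \<forall>M::nat \<ge> 2. \<exists>G :: (nat \<times> nat) spqn.
            wf_spqn G \<and> over_vars G (edgevars M) \<and> spqn_size G \<le> C * M ^ 4 \<and>
            cond_complete G \<and> cond_decomposable G \<and> cond_sound G \<and>
            (\<exists>d. tf_dist M d \<and>
                 (\<forall>S \<subseteq> edgevars M. Psi G (graph_asg M S) (root G) = d S))) \<and>
         (\<exists>C::nat. \<forall>M::nat \<ge> 2. \<exists>Gs :: nat \<Rightarrow> (nat \<times> nat) spqn.
            (\<forall>k. wf_spqn (Gs k) \<and> over_vars (Gs k) (edgevars M) \<and>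
                 spqn_size (Gs k) \<le> C * M ^ 4 \<and> cmo_composed (Gs k)) \<and>
            (\<exists>d. tf_dist M d \<and>
                 (\<forall>S \<subseteq> edgevars M.
                    (\<lambda>k. Psi (Gs k) (graph_asg M S) (root (Gs k))) \<longlonglongrightarrow> d S)))"
proof (intro conjI exI[of _ 63] allI impI)
  fix M :: nat assume M: "M \<ge> 2"
  \<comment> \<open>Names and ranks do not involve the bias, so a single numbering serves every
    \<open>\<epsilon>\<close>.\<close>
  obtain idx :: "name \<Rightarrow> nat" and bound :: nat where idx: "inj_on idx (names M)" "\<forall>n \<in> names M. idx n < bound"
      "\<forall>n \<in> names M. \<forall>n' \<in> names M. name_rank n < name_rank n' \<longrightarrow> idx n < idx n'"
    using exists_topological_numbering[OF finite_names[of M], of name_rank] by blast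
  have net: "triangle_net M \<epsilon> idx bound" if "0 \<le> \<epsilon>" "\<epsilon> < 1" for \<epsilon>
    using M idx that by unfold_locales auto
  show "\<exists>G :: (nat \<times> nat) spqn.
            wf_spqn G \<and> over_vars G (edgevars M) \<and> spqn_size G \<le> 63 * M ^ 4 \<and>
            cond_complete G \<and> cond_decomposable G \<and> cond_sound G \<and>
            (\<exists>d. tf_dist M d \<and>
                 (\<forall>S \<subseteq> edgevars M. Psi G (graph_asg M S) (root G) = d S))"
  proof -
    interpret triangle_net M 0 idx bound by (rule net) simp_all
    show ?thesis
      using wf_net over_vars_net size_net cond_complete_net cond_decomposable_net cond_sound_net
        tf_dist_top_val[of M] Psi_root_net
      unfolding cond_complete_def cond_decomposable_def by blast
  qed
  \<comment> \<open>The biases 1/(k+2) start at 1/2, so all of them lie strictly between 0 and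
    1.\<close>
  define \<delta> :: "nat \<Rightarrow> real" where "\<delta> k = inverse (real (Suc (Suc k)))" for k
  have \<delta>: "0 < \<delta> k" "\<delta> k < 1" for k
    by (auto simp: \<delta>_def field_simps)
  have lim: "\<delta> \<longlonglongrightarrow> 0"
    unfolding \<delta>_def by (rule LIMSEQ_Suc[OF LIMSEQ_inverse_real_of_nat])
  define Gs where "Gs k = triangle_net.net M (\<delta> k) idx bound" for k
  have Gs: "wf_spqn (Gs k) \<and> over_vars (Gs k) (edgevars M) \<and>
      spqn_size (Gs k) \<le> 63 * M ^ 4 \<and> cmo_composed (Gs k)"
    and Psi: "Psi (Gs k) a (root (Gs k)) = top_val M (\<delta> k) a" for k a
  proof -
    interpret triangle_net M "\<delta> k" idx bound by (rule net) (use \<delta>[of k] in auto)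
    show "wf_spqn (Gs k) \<and> over_vars (Gs k) (edgevars M) \<and>
      spqn_size (Gs k) \<le> 63 * M ^ 4 \<and> cmo_composed (Gs k)"
      and "Psi (Gs k) a (root (Gs k)) = top_val M (\<delta> k) a"
      using wf_net over_vars_net size_net cmo_composed_net[OF \<delta>(1)] Psi_root_net
      by (simp_all add: Gs_def)
  qed
  \<comment> \<open>The limit is the output at bias 0, the same distribution that the exact network
    computes.\<close>
  have "(\<lambda>k. Psi (Gs k) (graph_asg M S) (root (Gs k))) \<longlonglongrightarrow> top_val M 0 (graph_asg M S)" for S
    unfolding Psi by (rule tendsto_top_val[OF lim]) simp_all
  then show "\<exists>Gs :: nat \<Rightarrow> (nat \<times> nat) spqn.
            (\<forall>k. wf_spqn (Gs k) \<and> over_vars (Gs k) (edgevars M) \<and>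
                 spqn_size (Gs k) \<le> 63 * M ^ 4 \<and> cmo_composed (Gs k)) \<and>
            (\<exists>d. tf_dist M d \<and>
                 (\<forall>S \<subseteq> edgevars M.
                    (\<lambda>k. Psi (Gs k) (graph_asg M S) (root (Gs k))) \<longlonglongrightarrow> d S))"
    using Gs tf_dist_top_val[of M] by blast
qed

end
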